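(* Let $f:\mathbb{R}^n\to\mathbb{R}$ be a differentiable function that is $L_s$-RSS, let $0<\gamma\le \frac{1}{L_s}$, and let $\mathbf{x}\in\mathbb{R}^n$ be a sparse vector with $\|\mathbf{x}\|_0\le s$, with any choice of $\mathcal{I}^{\mathbf{x}}_s$. Let $\mathbf{y}\in H_s(\mathbf{x}-\gamma\nabla f(\mathbf{x}))$, with any choice of $\mathcal{I}^{\mathbf{y}}_s$. Then $$\frac{\gamma}{2}(1-L_s\gamma)\,\big\|\nabla_{\mathcal{I}^{\mathbf{x}}_s\cup\mathcal{I}^{\mathbf{y}}_s}f(\mathbf{x})\big\|_2^2\;\le\; f(\mathbf{x})-f(\mathbf{y}).$$
   Context: Here $s,n$ are integers with $1\le s<n$, and $\|\mathbf{x}\|_0$ is the number of nonzero entries of $\mathbf{x}$. RSS: a differentiable $f:\mathbb{R}^n\to\mathbb{R}$ is $L_s$-RSS (restricted strongly smooth with modulus $L_s>0$) if $f(\mathbf{y})\le f(\mathbf{x})+\langle\nabla f(\mathbf{x}),\mathbf{y}-\mathbf{x}\rangle+\frac{L_s}{2}\|\mathbf{y}-\mathbf{x}\|_2^2$ for all $\mathbf{x},\mathbf{y}\in\mathbb{R}^n$ with $\|\mathbf{x}\|_0\le s$ and $\|\mathbf{y}\|_0\le s$. Hard thresholding operator: $H_s(\mathbf{x})=\arg\min_{\|\mathbf{z}\|_0\le s}\|\mathbf{z}-\mathbf{x}\|_2$, a set of minimizers that may contain more than one element; $\mathbf{y}\in H_s(\mathbf{x})$ means $\mathbf{y}$ is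 any one of them. For $\mathbf{x}\in\mathbb{R}^n$, $\mathcal{I}^{\mathbf{x}}_s\subset\{1,\dots,n\}$ denotes a set of $s$ indices corresponding to the $s$ largest entries of $\mathbf{x}$ in absolute value (not unique when there are ties). For an index set $\mathcal{J}$, $\nabla_{\mathcal{J}}f(\mathbf{x})$ is the restriction of the gradient vector $\nabla f(\mathbf{x})$ to the entries indexed by $\mathcal{J}$. *)

theory Defs
  imports "HOL-Analysis.Analysis"
begin

definition l0 :: "real ^ 'n \<Rightarrow> nat"
  where "l0 x = card {i. x $ i \<noteq> 0}"

definition gradient :: "('a::euclidean_space \<Rightarrow> real) \<Rightarrow> 'a \<Rightarrow> 'a"
  where "gradient f x = (THE D. GDERIV f x :> D)"

lemma gderiv_gradient:
  fixes f :: "'a::euclidean_space \<Rightarrow> real"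
  assumes "f differentiable (at x)"
  shows "GDERIV f x :> gradient f x"
proof -
  from assms obtain f' where f': "(f has_derivative f') (at x)"
    unfolding differentiable_def by blast
  then interpret bounded_linear f' by (rule has_derivative_bounded_linear)
  have "f' h = h \<bullet> adjoint f' 1" for h
    using adjoint_works[OF linear_axioms, of h 1] by simp
  then have "f' = (\<lambda>h. h \<bullet> adjoint f' 1)" by (rule ext)
  with f' have D: "GDERIV f x :> adjoint f' 1"
    unfolding gderiv_def by simp
  show ?thesis
    unfolding gradient_def
  proof (rule theI[where P = "\<lambda>D. GDERIV f x :> D", OF D])
    fix E assume "GDERIV f x :> E"
    then have "(\<lambda>h. h \<bullet> E) = (\<lambda>h. h \<bullet> adjoint f' 1)"
      using D unfolding gderiv_def by (rule has_derivative_unique)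
    then have "\<forall>h. h \<bullet> E = h \<bullet> adjoint f' 1" by (rule fun_cong[THEN allI])
    then show "E = adjoint f' 1" by (simp only: vector_eq_ldot)
  qed
qed

definition restricted_strongly_smooth :: "nat \<Rightarrow> real \<Rightarrow> (real ^ 'n \<Rightarrow> real) \<Rightarrow> bool"
  where "restricted_strongly_smooth s L f \<longleftrightarrow>
    L > 0 \<and>
    (\<forall>x y. l0 x \<le> s \<longrightarrow> l0 y \<le> s \<longrightarrow>
      f y \<le> f x + gradient f x \<bullet> (y - x) + L / 2 * (norm (y - x))\<^sup>2)"

definition hard_threshold :: "nat \<Rightarrow> real ^ 'n \<Rightarrow> (real ^ 'n) set"
  where "hard_threshold s x = {y. is_arg_min (\<lambda>z. norm (z - x)) (\<lambda>z. l0 z \<le> s) y}"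

text \<open>All admissible choices of indices of the \<open>s\<close> entries of \<open>x\<close> that are largest in
  absolute value; ties, in particular among zero entries, may be broken arbitrarily.\<close>

definition top_indices :: "nat \<Rightarrow> real ^ 'n \<Rightarrow> 'n set set"
  where "top_indices s x =
    {I. card I = s \<and> (\<forall>i\<in>I. \<forall>j\<in>- I. \<bar>x $ j\<bar> \<le> \<bar>x $ i\<bar>)}"

end

theory Submission
  imports Defs
begin

text \<open>
  Write \<open>g\<close> for the gradient at \<open>x\<close> and \<open>u = x - \<gamma> g\<close> for the gradient step.
  Restricted smoothness bounds \<open>f x - f y\<close> below by \<open>- \<langle>g, y - x\<rangle> - L/2 \<parallel>y - x\<parallel>\<^sup>2\<close>, so only
  this quadratic expression has to be compared with the restricted gradient norm.

  Since \<open>x\<close> and \<open>y\<close> are \<open>s\<close>-sparse, they vanish off \<open>Ix\<close> and \<open>Iy\<close>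
  (\<open>sparse_zero_outside_top_indices\<close>). Optimality of \<open>y\<close> says that \<open>y\<close> agrees with \<open>u\<close> on \<open>Iy\<close>
  (\<open>hard_threshold_eq_on_top_indices\<close>), and that no index set with at most \<open>s\<close> elements carries
  more energy of \<open>u\<close> than \<open>Iy\<close> (\<open>hard_threshold_energy_maximal\<close>). Hence every coordinate of \<open>x\<close>,
  \<open>y\<close> and \<open>u\<close> is known in terms of \<open>g\<close> and \<open>x\<close>, and the claim can be checked coordinatewise, up to
  an error: on \<open>Ix - Iy\<close>, where an entry of \<open>x\<close> was discarded, the coordinatewise inequality may
  fail, but by no more than \<open>u\<^sub>k\<^sup>2 / (2 \<gamma>)\<close>, whereas on \<open>Iy - Ix\<close> there is a surplus of that amount
  (\<open>coordinate_descent\<close>). In the sum over all coordinates the error terms add up to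
  \<open>(\<Sum>\<^sub>I\<^sub>y u\<^sup>2 - \<Sum>\<^sub>I\<^sub>x u\<^sup>2) / (2 \<gamma>)\<close>, which is nonnegative because \<open>Iy\<close> has maximal energy.
\<close>

text \<open>Were an entry outside the chosen indices nonzero, all \<open>s\<close> chosen ones would dominate it and
  be nonzero too, giving more than \<open>s\<close> nonzero entries.\<close>

lemma sparse_zero_outside_top_indices:
  fixes x :: "real ^ 'n"
  assumes "l0 x \<le> s" and "I \<in> top_indices s x" and "k \<notin> I"
  shows "x $ k = 0"
proof (rule ccontr)
  assume nz: "x $ k \<noteq> 0"
  have "\<bar>x $ k\<bar> \<le> \<bar>x $ i\<bar>" if "i \<in> I" for i
    using that assms(2,3) by (auto simp: top_indices_def)
  then have "insert k I \<subseteq> {i. x $ i \<noteq> 0}"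
    using nz by force
  then have "card (insert k I) \<le> l0 x"
    unfolding l0_def by (intro card_mono) auto
  then show False
    using assms by (simp add: top_indices_def)
qed

lemma norm_power2_eq_sum_coordinates:
  fixes x :: "real ^ 'n"
  shows "(norm x)\<^sup>2 = (\<Sum>k\<in>UNIV. (x $ k)\<^sup>2)"
  by (simp add: norm_vec_def L2_set_def sum_nonneg)

text \<open>The vector that copies \<open>u\<close> on \<open>J\<close> and is zero elsewhere is a competitor in the minimization
  that defines hard thresholding; its squared distance to \<open>u\<close> is the energy of \<open>u\<close> off \<open>J\<close>.\<close>

lemma hard_threshold_dist_le_energy_outside:
  fixes u y :: "real ^ 'n"
  assumes "y \<in> hard_threshold s u" and "card J \<le> s"
  shows "(norm (y - u))\<^sup>2 \<le> (\<Sum>k\<in>- J. (u $ k)\<^sup>2)"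
proof -
  define z :: "real ^ 'n" where "z = (\<chi> k. if k \<in> J then u $ k else 0)"
  have "l0 z \<le> card J"
    unfolding l0_def z_def by (intro card_mono) auto
  with assms have "norm (y - u) \<le> norm (z - u)"
    by (auto simp: hard_threshold_def is_arg_min_linorder)
  then have "(norm (y - u))\<^sup>2 \<le> (norm (z - u))\<^sup>2"
    by (simp add: power_mono)
  also have "\<dots> = (\<Sum>k\<in>UNIV. if k \<in> - J then (u $ k)\<^sup>2 else 0)"
    unfolding norm_power2_eq_sum_coordinates z_def by (intro sum.cong) auto
  also have "\<dots> = (\<Sum>k\<in>- J. (u $ k)\<^sup>2)"
    by (simp add: sum.If_cases Compl_eq)
  finally show ?thesis .
qed

lemma dist_power2_split:
  fixes u y :: "real ^ 'n"
  assumes "\<And>k. k \<notin> I \<Longrightarrow> y $ k = 0"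
  shows "(norm (y - u))\<^sup>2 = (\<Sum>k\<in>I. (y $ k - u $ k)\<^sup>2) + (\<Sum>k\<in>- I. (u $ k)\<^sup>2)"
proof -
  have "(norm (y - u))\<^sup>2 = (\<Sum>k\<in>UNIV. (y $ k - u $ k)\<^sup>2)"
    by (simp add: norm_power2_eq_sum_coordinates)
  also have "\<dots> = (\<Sum>k\<in>I. (y $ k - u $ k)\<^sup>2) + (\<Sum>k\<in>- I. (y $ k - u $ k)\<^sup>2)"
    using sum.union_disjoint[of I "- I" "\<lambda>k. (y $ k - u $ k)\<^sup>2"] by simp
  also have "(\<Sum>k\<in>- I. (y $ k - u $ k)\<^sup>2) = (\<Sum>k\<in>- I. (u $ k)\<^sup>2)"
    using assms by (intro sum.cong) auto
  finally show ?thesis .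
qed

lemma hard_threshold_l0: "y \<in> hard_threshold s u \<Longrightarrow> l0 y \<le> s"
  by (simp add: hard_threshold_def is_arg_min_def)

text \<open>The entries off \<open>I\<close> already cost the full energy of \<open>u\<close> there, which is all that the copy
  of \<open>u\<close> on \<open>I\<close> costs; so nothing may be lost on \<open>I\<close>. This includes the case in which \<open>y\<close> has
  fewer than \<open>s\<close> nonzero entries: then \<open>u\<close> vanishes on the remaining indices of \<open>I\<close>.\<close>

lemma hard_threshold_eq_on_top_indices:
  fixes u y :: "real ^ 'n"
  assumes y: "y \<in> hard_threshold s u" and I: "I \<in> top_indices s y" and "k \<in> I"
  shows "y $ k = u $ k"
proof -
  have "card I \<le> s"
    using I by (simp add: top_indices_def)
  then have "(norm (y - u))\<^sup>2 \<le> (\<Sum>i\<in>- I. (u $ i)\<^sup>2)"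
    by (rule hard_threshold_dist_le_energy_outside[OF y])
  moreover have "(norm (y - u))\<^sup>2 = (\<Sum>i\<in>I. (y $ i - u $ i)\<^sup>2) + (\<Sum>i\<in>- I. (u $ i)\<^sup>2)"
    using sparse_zero_outside_top_indices[OF hard_threshold_l0[OF y] I] by (rule dist_power2_split)
  ultimately have "(\<Sum>i\<in>I. (y $ i - u $ i)\<^sup>2) \<le> 0"
    by simp
  then have "(\<Sum>i\<in>I. (y $ i - u $ i)\<^sup>2) = 0"
    by (simp add: order_antisym sum_nonneg)
  then show ?thesis
    using \<open>k \<in> I\<close> by (simp add: sum_nonneg_eq_0_iff)
qed

text \<open>The complements are compared by minimality of the distance, and the energies of an index set
  and its complement add up to the total energy of \<open>u\<close>.\<close>

lemma hard_threshold_energy_maximal: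
  fixes u y :: "real ^ 'n"
  assumes y: "y \<in> hard_threshold s u" and I: "I \<in> top_indices s y" and J: "card J \<le> s"
  shows "(\<Sum>k\<in>J. (u $ k)\<^sup>2) \<le> (\<Sum>k\<in>I. (u $ k)\<^sup>2)"
proof -
  have total: "(\<Sum>k\<in>K. (u $ k)\<^sup>2) + (\<Sum>k\<in>- K. (u $ k)\<^sup>2) = (\<Sum>k\<in>UNIV. (u $ k)\<^sup>2)" for K
    using sum.union_disjoint[of K "- K" "\<lambda>k. (u $ k)\<^sup>2"] by simp
  have "(norm (y - u))\<^sup>2 = (\<Sum>k\<in>I. (y $ k - u $ k)\<^sup>2) + (\<Sum>k\<in>- I. (u $ k)\<^sup>2)"
    using sparse_zero_outside_top_indices[OF hard_threshold_l0[OF y] I] by (rule dist_power2_split)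
  then have "(\<Sum>k\<in>- I. (u $ k)\<^sup>2) \<le> (norm (y - u))\<^sup>2"
    by (simp add: sum_nonneg)
  also have "\<dots> \<le> (\<Sum>k\<in>- J. (u $ k)\<^sup>2)"
    by (rule hard_threshold_dist_le_energy_outside[OF y J])
  finally show ?thesis
    using total[of I] total[of J] by linarith
qed

text \<open>Here \<open>g\<close>, \<open>a\<close>, \<open>b\<close> are the entries of the gradient, of \<open>x\<close> and of \<open>y\<close> at one index, which
  lies in \<open>Ix\<close> if \<open>P\<close> and in \<open>Iy\<close> if \<open>Q\<close>. The error term on the left is chosen so that it can be
  summed against maximality of the energy on \<open>Iy\<close>.\<close>

lemma coordinate_descent:
  fixes g a b L \<gamma> :: real
  assumes "0 < \<gamma>" and "0 < L" and "L * \<gamma> \<le> 1"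
    and P: "\<not> P \<Longrightarrow> a = 0" and Q: "\<not> Q \<Longrightarrow> b = 0" "Q \<Longrightarrow> b = a - \<gamma> * g"
  shows "\<gamma> / 2 * (1 - L * \<gamma>) * (if P \<or> Q then g\<^sup>2 else 0)
      + ((if Q then (a - \<gamma> * g)\<^sup>2 else 0) - (if P then (a - \<gamma> * g)\<^sup>2 else 0)) / (2 * \<gamma>)
    \<le> - (g * (b - a)) - L / 2 * (b - a)\<^sup>2"
proof (cases Q)
  case True
  then have b: "b - a = - (\<gamma> * g)"
    using Q by simp
  have "\<gamma> / 2 * (1 - L * \<gamma>) * g\<^sup>2 + \<gamma> / 2 * g\<^sup>2 = - (g * (b - a)) - L / 2 * (b - a)\<^sup>2"
    unfolding b by (simp add: field_simps power2_eq_square)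
  moreover have "0 \<le> \<gamma> / 2 * g\<^sup>2"
    using assms by simp
  moreover have "(a - \<gamma> * g)\<^sup>2 / (2 * \<gamma>) = \<gamma> / 2 * g\<^sup>2" if "\<not> P"
    using P[OF that] \<open>0 < \<gamma>\<close> by (simp add: field_simps power2_eq_square)
  ultimately show ?thesis
    using True by (cases P) simp_all
next
  case Qn: False
  then have b: "b = 0"
    using Q by simp
  show ?thesis
  proof (cases P)
    case True
    \<comment> \<open>The gap is found by completing the square: \<open>g a\<close> is replaced by means of
      \<open>(a - \<gamma> g)\<^sup>2 = a\<^sup>2 - 2 \<gamma> g a + \<gamma>\<^sup>2 g\<^sup>2\<close>. It is nonnegative because \<open>L \<gamma> \<le> 1\<close>.\<close>
    have "g * a - L / 2 * a\<^sup>2 - (\<gamma> / 2 * (1 - L * \<gamma>) * g\<^sup>2 - (a - \<gamma> * g)\<^sup>2 / (2 * \<gamma>))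
        = (1 - L * \<gamma>) * a\<^sup>2 / (2 * \<gamma>) + L * \<gamma>\<^sup>2 / 2 * g\<^sup>2"
      using \<open>0 < \<gamma>\<close> by (simp add: field_simps power2_eq_square)
    moreover have "0 \<le> (1 - L * \<gamma>) * a\<^sup>2 / (2 * \<gamma>) + L * \<gamma>\<^sup>2 / 2 * g\<^sup>2"
      using assms by simp
    ultimately show ?thesis
      using True Qn b by simp
  next
    case False
    then show ?thesis
      using P Qn b by simp
  qed
qed

theorem theorem1:
  fixes f :: "real ^ 'n \<Rightarrow> real"
    and s :: nat
    and L \<gamma> :: real
    and x y :: "real ^ 'n"
    and Ix Iy :: "'n set"
  assumes "1 \<le> s" and "s < CARD('n)"
    and "f differentiable_on UNIV"
    and "restricted_strongly_smooth s L f"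
    and "0 < \<gamma>" and "\<gamma> \<le> 1 / L"
    and "l0 x \<le> s"
    and "Ix \<in> top_indices s x"
    and "y \<in> hard_threshold s (x - \<gamma> *\<^sub>R gradient f x)"
    and "Iy \<in> top_indices s y"
  shows "\<gamma> / 2 * (1 - L * \<gamma>) * (L2_set (\<lambda>i. gradient f x $ i) (Ix \<union> Iy))\<^sup>2 \<le> f x - f y"
proof -
  define g where "g = gradient f x"
  define u where "u = x - \<gamma> *\<^sub>R g"
  define c where "c = \<gamma> / 2 * (1 - L * \<gamma>)"
  have L: "0 < L"
    and smooth: "f y \<le> f x + g \<bullet> (y - x) + L / 2 * (norm (y - x))\<^sup>2"
    using assms(4,7) hard_threshold_l0[OF assms(9)]
    by (auto simp: restricted_strongly_smooth_def g_def)
  have L\<gamma>: "L * \<gamma> \<le> 1"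
    using assms(6) L by (simp add: field_simps)
  have y: "y \<in> hard_threshold s u"
    using assms(9) by (simp add: u_def g_def)
  have coordinate: "c * (if k \<in> Ix \<or> k \<in> Iy then (g $ k)\<^sup>2 else 0)
      + ((if k \<in> Iy then (u $ k)\<^sup>2 else 0) - (if k \<in> Ix then (u $ k)\<^sup>2 else 0)) / (2 * \<gamma>)
    \<le> - (g $ k * (y $ k - x $ k)) - L / 2 * (y $ k - x $ k)\<^sup>2" for k
  proof -
    have "x $ k = 0" if "k \<notin> Ix"
      using sparse_zero_outside_top_indices[OF assms(7,8) that] .
    moreover have "y $ k = 0" if "k \<notin> Iy"
      using sparse_zero_outside_top_indices[OF hard_threshold_l0[OF y] assms(10) that] .
    moreover have u: "u $ k = x $ k - \<gamma> * g $ k"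
      by (simp add: u_def)
    moreover have "y $ k = x $ k - \<gamma> * g $ k" if "k \<in> Iy"
      using hard_threshold_eq_on_top_indices[OF y assms(10) that] u by simp
    ultimately show ?thesis
      unfolding c_def u by (intro coordinate_descent[OF assms(5) L L\<gamma>])
  qed
  have restrict: "(\<Sum>k\<in>UNIV. if k \<in> K then h k else 0) = sum h K" for h :: "'n \<Rightarrow> real" and K
    by (simp add: sum.If_cases)
  have "card Ix \<le> s"
    using assms(8) by (simp add: top_indices_def)
  then have energy: "0 \<le> ((\<Sum>k\<in>Iy. (u $ k)\<^sup>2) - (\<Sum>k\<in>Ix. (u $ k)\<^sup>2)) / (2 * \<gamma>)"
    using hard_threshold_energy_maximal[OF y assms(10)] assms(5) by simp
  have "c * (L2_set (\<lambda>i. g $ i) (Ix \<union> Iy))\<^sup>2 = c * (\<Sum>k\<in>Ix \<union> Iy. (g $ k)\<^sup>2)"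
    by (simp add: L2_set_def sum_nonneg)
  also have "\<dots> \<le> c * (\<Sum>k\<in>Ix \<union> Iy. (g $ k)\<^sup>2)
      + ((\<Sum>k\<in>Iy. (u $ k)\<^sup>2) - (\<Sum>k\<in>Ix. (u $ k)\<^sup>2)) / (2 * \<gamma>)"
    using energy by simp
  also have "\<dots> = (\<Sum>k\<in>UNIV. c * (if k \<in> Ix \<or> k \<in> Iy then (g $ k)\<^sup>2 else 0)
      + ((if k \<in> Iy then (u $ k)\<^sup>2 else 0) - (if k \<in> Ix then (u $ k)\<^sup>2 else 0)) / (2 * \<gamma>))"
    unfolding sum.distrib sum_divide_distrib[symmetric] sum_subtractf sum_distrib_left[symmetric]
      restrict Un_iff[symmetric] ..
  also have "\<dots> \<le> (\<Sum>k\<in>UNIV. - (g $ k * (y $ k - x $ k)) - L / 2 * (y $ k - x $ k)\<^sup>2)"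
    by (intro sum_mono coordinate)
  also have "\<dots> = - (g \<bullet> (y - x)) - L / 2 * (norm (y - x))\<^sup>2"
    by (simp add: inner_vec_def norm_power2_eq_sum_coordinates sum_subtractf sum_negf
        sum_distrib_left)
  also have "\<dots> \<le> f x - f y"
    using smooth by linarith
  finally show ?thesis
    by (simp add: c_def g_def)
qed

end
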